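(* Let $X=\{-1,1\}^{\mathbb N}$, $h\in\mathbb R$, and let $(a_k)_{k\ge1}$ satisfy $a_k\ge0$ for all $k\ge1$ and $\sum_{k\ge1}a_k<\infty$. Let $A(x)=hx_0+x_0\sum_{k\ge1}a_kx_k$. Let $n\ge1$ and let $f:X\to\mathbb R$ be an increasing function depending only on its first $n$ coordinates. Then for every $x\in X$ $$\frac{\mathscr L_A^{n-1}(f)(-1^\infty)}{\mathscr L_A^{n-1}(1)(-1^\infty)}\le\frac{\mathscr L_A^{n}(f)(-1^\infty)}{\mathscr L_A^{n}(1)(-1^\infty)}\le\frac{\mathscr L_A^{n}(f)(\sigma^n(x))}{\mathscr L_A^{n}(1)(\sigma^n(x))}\le\frac{\mathscr L_A^{n}(f)(1^\infty)}{\mathscr L_A^{n}(1)(1^\infty)}\le\frac{\mathscr L_A^{n-1}(f)(1^\infty)}{\mathscr L_A^{n-1}(1)(1^\infty)} .$$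
   Context: $\mathbb N=\{0,1,2,\dots\}$; $\sigma(x_0,x_1,\dots)=(x_1,x_2,\dots)$; $1^\infty=(1,1,1,\dots)$ and $-1^\infty=(-1,-1,-1,\dots)$. Partial order: $x\succeq y$ iff $x_j\ge y_j$ for all $j$; $f$ is increasing if $x\succeq y$ implies $f(x)\ge f(y)$. The Ruelle operator is $\mathscr L_A(f)(x)=\sum_{i\in\{-1,1\}}e^{A(i,x_0,x_1,\dots)}f(i,x_0,x_1,\dots)$, and $\mathscr L_A^0$ is the identity. *)

theory Defs
  imports "HOL-Analysis.Analysis"
begin

text \<open>
  The space of spin configurations, as a set of real sequences. The coordinatewise partial order on
  configurations is the library order on functions, so increasing functions are those with
  \<^term>\<open>mono_on spin_space f\<close>. Only the values on \<open>spin_space\<close> of functions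
  of type \<^typ>\<open>(nat \<Rightarrow> real) \<Rightarrow> real\<close> are relevant.
\<close>

definition spin_space :: "(nat \<Rightarrow> real) set" where
  "spin_space = {x. \<forall>j. x j \<in> {-1, 1}}"

definition left_shift :: "(nat \<Rightarrow> 'a) \<Rightarrow> nat \<Rightarrow> 'a" where
  "left_shift x = (\<lambda>j. x (Suc j))"

definition depends_on_first :: "nat \<Rightarrow> ((nat \<Rightarrow> real) \<Rightarrow> real) \<Rightarrow> bool" where
  "depends_on_first n f \<longleftrightarrow>
     (\<forall>x\<in>spin_space. \<forall>y\<in>spin_space. (\<forall>j<n. x j = y j) \<longrightarrow> f x = f y)"

text \<open>\<^term>\<open>case_nat i x\<close> is the sequence \<open>(i, x 0, x 1, \<dots>)\<close>.\<close>

definition ruelle ::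
  "((nat \<Rightarrow> real) \<Rightarrow> real) \<Rightarrow> ((nat \<Rightarrow> real) \<Rightarrow> real) \<Rightarrow> (nat \<Rightarrow> real) \<Rightarrow> real" where
  "ruelle A f x = (\<Sum>i\<in>{-1, 1}. exp (A (case_nat i x)) * f (case_nat i x))"

text \<open>The coefficients are indexed from 1; \<open>a 0\<close> is not used.\<close>

definition spin_potential :: "real \<Rightarrow> (nat \<Rightarrow> real) \<Rightarrow> (nat \<Rightarrow> real) \<Rightarrow> real" where
  "spin_potential h a x = h * x 0 + x 0 * (\<Sum>k. a (Suc k) * x (Suc k))"

end

theory Submission
  imports Defs
begin

text \<open>
  Write \<open>Z\<^sub>n = L\<^sup>n 1\<close> and \<open>R\<^sub>n = L\<^sup>n f / Z\<^sub>n\<close>. Since the couplings are nonnegative, the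
  potential is supermodular; the two-point case of the Ahlswede--Daykin inequality shows that the
  Ruelle operator then preserves log-supermodularity, so every \<open>Z\<^sub>n\<close> is log-supermodular.
  Now \<open>R\<^sub>n\<^sub>+\<^sub>1(y)\<close> is the average of \<open>R\<^sub>n(1, y)\<close> and \<open>R\<^sub>n(-1, y)\<close> with weights
  \<open>exp(A(i, y)) Z\<^sub>n(i, y)\<close>, whose ratio is increasing in \<open>y\<close> by log-supermodularity. By induction
  \<open>R\<^sub>n\<close> is increasing, for every increasing \<open>f\<close>. This gives the two inner inequalities. The
  outer ones hold because \<open>R\<^sub>n(-1\<^sup>\<infinity>)\<close> averages values of \<open>R\<^sub>n\<^sub>-\<^sub>1\<close> at points above
  \<open>-1\<^sup>\<infinity>\<close>, and dually at \<open>1\<^sup>\<infinity>\<close>.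
\<close>

definition supermodular_on :: "'a::lattice set \<Rightarrow> ('a \<Rightarrow> real) \<Rightarrow> bool" where
  "supermodular_on S g \<longleftrightarrow> (\<forall>x\<in>S. \<forall>y\<in>S. g x + g y \<le> g (sup x y) + g (inf x y))"

text \<open>This is the FKG lattice condition.\<close>

definition log_supermodular_on :: "'a::lattice set \<Rightarrow> ('a \<Rightarrow> real) \<Rightarrow> bool" where
  "log_supermodular_on S g \<longleftrightarrow> (\<forall>x\<in>S. \<forall>y\<in>S. g x * g y \<le> g (sup x y) * g (inf x y))"

lemma log_supermodular_on_exp_mult:
  assumes "supermodular_on S A" "log_supermodular_on S g" "\<And>x. 0 \<le> g x"
  shows "log_supermodular_on S (\<lambda>x. exp (A x) * g x)"
  unfolding log_supermodular_on_def
proof (intro ballI)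
  fix x y assume xy: "x \<in> S" "y \<in> S"
  have "exp (A x + A y) * (g x * g y)
      \<le> exp (A (sup x y) + A (inf x y)) * (g (sup x y) * g (inf x y))"
  proof (rule mult_mono)
    show "exp (A x + A y) \<le> exp (A (sup x y) + A (inf x y))"
      using assms(1) xy by (simp add: supermodular_on_def)
    show "g x * g y \<le> g (sup x y) * g (inf x y)"
      using assms(2) xy by (simp add: log_supermodular_on_def)
  qed (simp_all add: assms(3))
  then show "exp (A x) * g x * (exp (A y) * g y)
      \<le> exp (A (sup x y)) * g (sup x y) * (exp (A (inf x y)) * g (inf x y))"
    by (simp add: exp_add mult_ac)
qed

lemma spin_spaceD: "x \<in> spin_space \<Longrightarrow> x j = -1 \<or> x j = 1"
  by (auto simp: spin_space_def)

lemma const_in_spin_space [simp]: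
  "(\<lambda>_. -1) \<in> spin_space" "(\<lambda>_. 1) \<in> spin_space"
  by (auto simp: spin_space_def)

lemma case_nat_in_spin_space [simp]:
  "case_nat i x \<in> spin_space \<longleftrightarrow> i \<in> {-1, 1} \<and> x \<in> spin_space"
proof -
  have "(\<forall>j. case_nat i x j \<in> {-1, 1}) \<longleftrightarrow> i \<in> {-1, 1} \<and> (\<forall>j. x j \<in> {-1, 1})"
    by (metis nat.case nat.exhaust)
  then show ?thesis
    by (simp add: spin_space_def)
qed

lemma sup_inf_in_spin_space [simp]:
  assumes "x \<in> spin_space" "y \<in> spin_space"
  shows "sup x y \<in> spin_space" "inf x y \<in> spin_space"
  using assms by (auto simp: spin_space_def sup_max inf_min max_def min_def)

lemma left_shift_funpow_in_spin_space:
  "x \<in> spin_space \<Longrightarrow> (left_shift ^^ n) x \<in> spin_space"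
  by (induction n) (auto simp: left_shift_def spin_space_def)

lemma spin_space_bounds:
  assumes "x \<in> spin_space"
  shows "(\<lambda>_. -1) \<le> x" "x \<le> (\<lambda>_. 1)"
proof -
  have "-1 \<le> x j \<and> x j \<le> 1" for j
    using spin_spaceD[OF assms, of j] by auto
  then show "(\<lambda>_. -1) \<le> x" "x \<le> (\<lambda>_. 1)"
    by (auto simp: le_fun_def)
qed

lemma sup_case_nat:
  fixes i j :: "'a::lattice"
  shows "sup (case_nat i x) (case_nat j y) = case_nat (sup i j) (sup x y)"
  by (auto simp: fun_eq_iff split: nat.splits)

lemma inf_case_nat:
  fixes i j :: "'a::lattice"
  shows "inf (case_nat i x) (case_nat j y) = case_nat (inf i j) (inf x y)"
  by (auto simp: fun_eq_iff split: nat.splits)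

lemma case_nat_mono: "i \<le> j \<Longrightarrow> x \<le> y \<Longrightarrow> case_nat i x \<le> case_nat j y"
  by (auto simp: le_fun_def split: nat.splits)

text \<open>If the pairs \<open>(u, v)\<close> and \<open>(u', v')\<close> are comparable,
  \<open>sup\<close> and \<open>inf\<close> only permute them and equality holds. Otherwise the
  right side exceeds the left by \<open>- (u - u') * (v - v')\<close>, which is nonnegative.\<close>

lemma mult_supermodular_real:
  fixes u v u' v' :: real
  shows "u * v + u' * v' \<le> sup u u' * sup v v' + inf u u' * inf v v'"
proof -
  have "(u - u') * (v - v') \<le> 0" if "u \<le> u' \<and> v' \<le> v \<or> u' \<le> u \<and> v \<le> v'"
    using that by (auto simp: mult_le_0_iff)
  then show ?thesis
    by (auto simp: sup_max inf_min max_def min_def algebra_simps)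
qed

lemma summable_mult_spins:
  assumes "summable a" "\<And>k. 0 \<le> a k" "x \<in> spin_space"
  shows "summable (\<lambda>k. a k * x (Suc k))"
proof (rule summable_comparison_test'[OF assms(1)])
  show "norm (a k * x (Suc k)) \<le> a k" for k
    using assms(2)[of k] spin_spaceD[OF assms(3), of "Suc k"] by auto
qed

lemma supermodular_spin_potential:
  assumes a: "\<And>k. 0 \<le> a (Suc k)" "summable (\<lambda>k. a (Suc k))"
  shows "supermodular_on spin_space (spin_potential h a)"
  unfolding supermodular_on_def
proof (intro ballI)
  fix x y assume xy: "x \<in> spin_space" "y \<in> spin_space"
  \<comment> \<open>Moving \<open>z 0\<close> inside the series makes every term a nonnegative
    multiple of a product of two coordinates, so supermodularity can be checked term by
    term.\<close>
  have pot: "spin_potential h a z = h * z 0 + (\<Sum>k. a (Suc k) * (z 0 * z (Suc k)))"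
    and summ: "summable (\<lambda>k. a (Suc k) * (z 0 * z (Suc k)))" if "z \<in> spin_space" for z
  proof -
    have s: "summable (\<lambda>k. a (Suc k) * z (Suc k))"
      by (rule summable_mult_spins) (use a that in auto)
    show "summable (\<lambda>k. a (Suc k) * (z 0 * z (Suc k)))"
      using summable_mult[OF s, of "z 0"] by (simp add: mult_ac)
    show "spin_potential h a z = h * z 0 + (\<Sum>k. a (Suc k) * (z 0 * z (Suc k)))"
      using suminf_mult[OF s, of "z 0"] by (simp add: spin_potential_def mult_ac)
  qed
  have "(\<Sum>k. a (Suc k) * (x 0 * x (Suc k)) + a (Suc k) * (y 0 * y (Suc k)))
      \<le> (\<Sum>k. a (Suc k) * (sup x y 0 * sup x y (Suc k))
             + a (Suc k) * (inf x y 0 * inf x y (Suc k)))"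
  proof (rule suminf_le)
    show "a (Suc k) * (x 0 * x (Suc k)) + a (Suc k) * (y 0 * y (Suc k))
      \<le> a (Suc k) * (sup x y 0 * sup x y (Suc k)) + a (Suc k) * (inf x y 0 * inf x y (Suc k))" for k
      unfolding distrib_left[symmetric] sup_fun_def inf_fun_def
      by (intro mult_left_mono mult_supermodular_real a)
  qed (intro summable_add summ xy sup_inf_in_spin_space)+
  note sums = this[folded suminf_add[OF summ[OF xy(1)] summ[OF xy(2)]]
      suminf_add[OF summ[OF sup_inf_in_spin_space(1)[OF xy]] summ[OF sup_inf_in_spin_space(2)[OF xy]]]]
  \<comment> \<open>The field term depends on a single coordinate, so it is modular whatever the
    sign of \<open>h\<close>.\<close>
  have "h * x 0 + h * y 0 = h * sup x y 0 + h * inf x y 0"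
    by (auto simp: sup_max inf_min max_def min_def)
  then show "spin_potential h a x + spin_potential h a y
      \<le> spin_potential h a (sup x y) + spin_potential h a (inf x y)"
    unfolding pot[OF xy(1)] pot[OF xy(2)] pot[OF sup_inf_in_spin_space(1)[OF xy]]
      pot[OF sup_inf_in_spin_space(2)[OF xy]]
    using sums by linarith
qed

lemma ruelle_eq:
  "ruelle A f x = exp (A (case_nat 1 x)) * f (case_nat 1 x)
                + exp (A (case_nat (-1) x)) * f (case_nat (-1) x)"
  by (simp add: ruelle_def)

text \<open>Expanding \<open>(c - a) * (c - b)\<close> gives \<open>c * (a + b)\<close> \<le>
  \<open>c * c + a * b\<close> \<le> \<open>c * (c + d)\<close>, and \<open>c\<close> cancels. This
  is the elementary step behind the two-point Ahlswede--Daykin inequality.\<close>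

lemma add_le_add_of_mult_le_mult:
  fixes a b c d :: real
  assumes "a \<le> c" "b \<le> c" "a * b \<le> c * d" "0 < c"
  shows "a + b \<le> c + d"
proof -
  have "0 \<le> (c - a) * (c - b)"
    using assms by simp
  then have "c * (a + b) \<le> c * (c + d)"
    using assms by (simp add: algebra_simps)
  then show ?thesis
    using assms by simp
qed

text \<open>Both sides are products of two-term sums. After expansion the equal-letter terms compare
  one by one, but the two mixed terms compare only as a sum.\<close>

lemma log_supermodular_ruelle:
  assumes "supermodular_on spin_space A" "log_supermodular_on spin_space g" "\<And>x. 0 < g x"
  shows "log_supermodular_on spin_space (ruelle A g)"
  unfolding log_supermodular_on_def
proof (intro ballI)
  fix x y assume xy: "x \<in> spin_space" "y \<in> spin_space"
  define G where "G i z = exp (A (case_nat i z)) * g (case_nat i z)" for i z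
  have pos: "0 < G i z" for i z
    by (simp add: G_def assms)
  have G: "G i x * G j y \<le> G (sup i j) (sup x y) * G (inf i j) (inf x y)"
    if "i \<in> {-1, 1}" "j \<in> {-1, 1}" for i j
  proof -
    have "log_supermodular_on spin_space (\<lambda>x. exp (A x) * g x)"
      using assms by (intro log_supermodular_on_exp_mult) (auto intro: less_imp_le)
    from this[unfolded log_supermodular_on_def, rule_format, of "case_nat i x" "case_nat j y"]
    show ?thesis
      using xy that by (simp add: G_def sup_case_nat inf_case_nat)
  qed
  have diag: "G i x * G i y \<le> G i (sup x y) * G i (inf x y)" if "i \<in> {-1, 1}" for i
    using G[OF that that] by simp
  \<comment> \<open>Both mixed terms have the same bound, since \<open>sup\<close> and
    \<open>inf\<close> of the letters 1 and -1 do not depend on their order.\<close>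
  have cross: "G 1 x * G (-1) y \<le> G 1 (sup x y) * G (-1) (inf x y)"
    "G (-1) x * G 1 y \<le> G 1 (sup x y) * G (-1) (inf x y)"
    using G[of 1 "-1"] G[of "-1" 1] by (simp_all add: sup_max inf_min)
  \<comment> \<open>Multiplying the two equal-letter inequalities and regrouping the factors bounds
    the product of the mixed terms.\<close>
  have "(G 1 x * G 1 y) * (G (-1) x * G (-1) y)
      \<le> (G 1 (sup x y) * G 1 (inf x y)) * (G (-1) (sup x y) * G (-1) (inf x y))"
    using pos by (intro mult_mono diag mult_nonneg_nonneg) (auto intro: less_imp_le)
  then have "(G 1 x * G (-1) y) * (G (-1) x * G 1 y)
      \<le> (G 1 (sup x y) * G (-1) (inf x y)) * (G (-1) (sup x y) * G 1 (inf x y))"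
    by (simp only: mult_ac)
  then have "G 1 x * G (-1) y + G (-1) x * G 1 y
      \<le> G 1 (sup x y) * G (-1) (inf x y) + G (-1) (sup x y) * G 1 (inf x y)"
    by (rule add_le_add_of_mult_le_mult[OF cross _ mult_pos_pos[OF pos pos]])
  moreover have "G 1 x * G 1 y \<le> G 1 (sup x y) * G 1 (inf x y)"
    "G (-1) x * G (-1) y \<le> G (-1) (sup x y) * G (-1) (inf x y)"
    by (intro diag; simp)+
  ultimately have "(G 1 x + G (-1) x) * (G 1 y + G (-1) y)
      \<le> (G 1 (sup x y) + G (-1) (sup x y)) * (G 1 (inf x y) + G (-1) (inf x y))"
    unfolding distrib_left distrib_right by linarith
  then show "ruelle A g x * ruelle A g y \<le> ruelle A g (sup x y) * ruelle A g (inf x y)"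
    by (simp only: ruelle_eq G_def)
qed

lemma ruelle_funpow_pos: "(\<And>x. 0 < g x) \<Longrightarrow> 0 < (ruelle A ^^ n) g x"
  by (induction n arbitrary: x) (auto simp: ruelle_eq intro: add_pos_pos)

lemma log_supermodular_ruelle_funpow_one:
  assumes "supermodular_on spin_space A"
  shows "log_supermodular_on spin_space ((ruelle A ^^ n) (\<lambda>_. 1))"
proof (induction n)
  case 0
  show ?case
    by (simp add: log_supermodular_on_def)
next
  case (Suc n)
  then show ?case
    using log_supermodular_ruelle[OF assms Suc.IH] by (simp add: ruelle_funpow_pos)
qed

text \<open>The expectation of \<open>f\<close> under the finite-volume Gibbs measure on
  \<open>n\<close> sites with boundary condition \<open>x\<close>.\<close>

definition ruelle_ratio ::
  "((nat \<Rightarrow> real) \<Rightarrow> real) \<Rightarrow> nat \<Rightarrow> ((nat \<Rightarrow> real) \<Rightarrow> real) \<Rightarrow> (nat \<Rightarrow> real) \<Rightarrow> real" where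
  "ruelle_ratio A n f x = (ruelle A ^^ n) f x / (ruelle A ^^ n) (\<lambda>_. 1) x"

text \<open>At \<open>case_nat i y\<close> this is the unnormalised Gibbs mass, on
  \<open>n + 1\<close> sites with boundary condition \<open>y\<close>, of the words whose letter
  next to \<open>y\<close> is \<open>i\<close>.\<close>

definition ruelle_weight ::
  "((nat \<Rightarrow> real) \<Rightarrow> real) \<Rightarrow> nat \<Rightarrow> (nat \<Rightarrow> real) \<Rightarrow> real" where
  "ruelle_weight A n x = exp (A x) * (ruelle A ^^ n) (\<lambda>_. 1) x"

lemma ruelle_weight_pos: "0 < ruelle_weight A n x"
  by (simp add: ruelle_weight_def ruelle_funpow_pos)

text \<open>Conditioning on the letter adjacent to \<open>x\<close>.\<close>

lemma ruelle_ratio_Suc: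
  "ruelle_ratio A (Suc n) f x =
     (ruelle_weight A n (case_nat 1 x) * ruelle_ratio A n f (case_nat 1 x)
      + ruelle_weight A n (case_nat (-1) x) * ruelle_ratio A n f (case_nat (-1) x))
     / (ruelle_weight A n (case_nat 1 x) + ruelle_weight A n (case_nat (-1) x))"
proof -
  have "(ruelle A ^^ n) (\<lambda>_. 1) z \<noteq> 0" for z
    using ruelle_funpow_pos[where g = "\<lambda>_. 1" and A = A and n = n and x = z] by simp
  then show ?thesis
    by (simp add: ruelle_ratio_def ruelle_weight_def ruelle_eq)
qed

text \<open>The hypothesis on the weights says that the odds \<open>p / q\<close> of the larger
  value \<open>r\<close> increase. Changing the weights first and the values second raises the
  average twice.\<close>

lemma weighted_average_mono:
  fixes p q p' q' r s r' s' :: real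
  assumes pos: "0 < p" "0 < q" "0 < p'" "0 < q'"
    and le: "r \<le> r'" "s \<le> s'" "s \<le> r" and weights: "p * q' \<le> p' * q"
  shows "(p * r + q * s) / (p + q) \<le> (p' * r' + q' * s') / (p' + q')"
proof -
  \<comment> \<open>This product is exactly the difference of the cross-multiplied averages of
    \<open>r\<close> and \<open>s\<close> for the two weightings.\<close>
  have "0 \<le> (r - s) * (p' * q - p * q')"
    using le weights by simp
  then have "(p * r + q * s) * (p' + q') \<le> (p' * r + q' * s) * (p + q)"
    by (simp add: algebra_simps)
  also have "\<dots> \<le> (p' * r' + q' * s') * (p + q)"
    using pos le by (intro mult_right_mono add_mono mult_left_mono) auto
  finally show ?thesis
    using pos by (simp add: divide_simps add_pos_pos mult_ac)
qed

lemma mono_on_ruelle_ratio: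
  assumes A: "supermodular_on spin_space A" and f: "mono_on spin_space f"
  shows "mono_on spin_space (ruelle_ratio A n f)"
proof (induction n)
  case 0
  show ?case
    using f by (simp add: ruelle_ratio_def [abs_def])
next
  case (Suc n)
  note IH = mono_onD[OF Suc.IH]
  show ?case
  proof (rule mono_onI)
    fix x y assume xy: "x \<in> spin_space" "y \<in> spin_space" "x \<le> y"
    have "log_supermodular_on spin_space (ruelle_weight A n)"
      unfolding ruelle_weight_def
      by (intro log_supermodular_on_exp_mult A log_supermodular_ruelle_funpow_one)
        (simp add: ruelle_funpow_pos less_imp_le)
    \<comment> \<open>As \<open>x\<close> \<le> \<open>y\<close>, the join of these two points is
      \<open>case_nat 1 y\<close> and their meet is \<open>case_nat (-1) x\<close>, so the lattice
      condition says that the odds of the letter 1 increase with the boundary condition.\<close>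
    from this[unfolded log_supermodular_on_def, rule_format,
        of "case_nat 1 x" "case_nat (-1) y"]
    have weights: "ruelle_weight A n (case_nat 1 x) * ruelle_weight A n (case_nat (-1) y)
        \<le> ruelle_weight A n (case_nat 1 y) * ruelle_weight A n (case_nat (-1) x)"
      using xy by (simp add: sup_case_nat inf_case_nat sup_absorb1 sup_absorb2 inf_absorb1 inf_absorb2)
    show "ruelle_ratio A (Suc n) f x \<le> ruelle_ratio A (Suc n) f y"
      unfolding ruelle_ratio_Suc
      \<comment> \<open>The induction hypothesis serves three times: from \<open>x\<close> to
        \<open>y\<close> for each letter, and from letter -1 to letter 1 at
        \<open>x\<close>.\<close>
      by (intro weighted_average_mono weights ruelle_weight_pos IH)
        (use xy in \<open>auto intro: case_nat_mono\<close>)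
  qed
qed

lemma ruelle_ratio_Suc_ge:
  assumes "\<And>i. i \<in> {-1, 1} \<Longrightarrow> c \<le> ruelle_ratio A n f (case_nat i x)"
  shows "c \<le> ruelle_ratio A (Suc n) f x"
  unfolding ruelle_ratio_Suc
  using assms[of 1] assms[of "-1"] ruelle_weight_pos[of A n]
  by (simp add: pos_le_divide_eq add_pos_pos distrib_left add_mono mult.commute[of c])

lemma ruelle_ratio_Suc_le:
  assumes "\<And>i. i \<in> {-1, 1} \<Longrightarrow> ruelle_ratio A n f (case_nat i x) \<le> c"
  shows "ruelle_ratio A (Suc n) f x \<le> c"
  unfolding ruelle_ratio_Suc
  using assms[of 1] assms[of "-1"] ruelle_weight_pos[of A n]
  by (simp add: pos_divide_le_eq add_pos_pos distrib_left add_mono mult.commute[of c])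

theorem corollary5:
  fixes h :: real and a :: "nat \<Rightarrow> real" and n :: nat
    and f :: "(nat \<Rightarrow> real) \<Rightarrow> real" and x :: "nat \<Rightarrow> real"
  defines "L \<equiv> ruelle (spin_potential h a)"
  assumes "\<And>k. k \<ge> 1 \<Longrightarrow> a k \<ge> 0"
    and "summable (\<lambda>k. a (Suc k))"
    and "n \<ge> 1"
    and "mono_on spin_space f"
    and "depends_on_first n f"
    and "x \<in> spin_space"
  shows "(L ^^ (n - 1)) f (\<lambda>_. - 1) / (L ^^ (n - 1)) (\<lambda>_. 1) (\<lambda>_. - 1)
           \<le> (L ^^ n) f (\<lambda>_. - 1) / (L ^^ n) (\<lambda>_. 1) (\<lambda>_. - 1)
       \<and> (L ^^ n) f (\<lambda>_. - 1) / (L ^^ n) (\<lambda>_. 1) (\<lambda>_. - 1)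
           \<le> (L ^^ n) f ((left_shift ^^ n) x) / (L ^^ n) (\<lambda>_. 1) ((left_shift ^^ n) x)
       \<and> (L ^^ n) f ((left_shift ^^ n) x) / (L ^^ n) (\<lambda>_. 1) ((left_shift ^^ n) x)
           \<le> (L ^^ n) f (\<lambda>_. 1) / (L ^^ n) (\<lambda>_. 1) (\<lambda>_. 1)
       \<and> (L ^^ n) f (\<lambda>_. 1) / (L ^^ n) (\<lambda>_. 1) (\<lambda>_. 1)
           \<le> (L ^^ (n - 1)) f (\<lambda>_. 1) / (L ^^ (n - 1)) (\<lambda>_. 1) (\<lambda>_. 1)"
proof -
  define A where "A = spin_potential h a"
  obtain m where n: "n = Suc m"
    using \<open>n \<ge> 1\<close> by (cases n) auto
  have "supermodular_on spin_space A"
    unfolding A_def using assms by (intro supermodular_spin_potential) auto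
  then have mono: "ruelle_ratio A k f y \<le> ruelle_ratio A k f z"
    if "y \<in> spin_space" "z \<in> spin_space" "y \<le> z" for k y z
    using mono_onD[OF mono_on_ruelle_ratio that] \<open>mono_on spin_space f\<close> by simp
  \<comment> \<open>Prepending either letter to the lowest configuration gives a point above it, so
    both averaged values are at least the old ratio.\<close>
  have "ruelle_ratio A m f (\<lambda>_. -1) \<le> ruelle_ratio A n f (\<lambda>_. -1)"
    unfolding n by (intro ruelle_ratio_Suc_ge mono spin_space_bounds) auto
  moreover have "ruelle_ratio A n f (\<lambda>_. 1) \<le> ruelle_ratio A m f (\<lambda>_. 1)"
    unfolding n by (intro ruelle_ratio_Suc_le mono spin_space_bounds) auto
  moreover have "ruelle_ratio A n f (\<lambda>_. -1) \<le> ruelle_ratio A n f ((left_shift ^^ n) x)"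
    "ruelle_ratio A n f ((left_shift ^^ n) x) \<le> ruelle_ratio A n f (\<lambda>_. 1)"
    using \<open>x \<in> spin_space\<close>
    by (intro mono spin_space_bounds left_shift_funpow_in_spin_space; simp)+
  ultimately show ?thesis
    by (simp add: ruelle_ratio_def L_def A_def n del: funpow.simps)
qed

end
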